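(* Let $\phi$ be a positive kinematic expansive continuous flow on a compact metric space $X$. If $\gamma$ is a periodic orbit of $\phi$, then there exists $\delta>0$ such that if $x\in X$, $\phi_{\mathbb{R}^+}(x)\subset B_\delta(\gamma)$ and $x\notin\gamma$, then $x$ is a periodic point.
   Context: A continuous flow $\phi$ on a compact metric space $(X,\operatorname{dist})$ is positive kinematic expansive if for all $\epsilon>0$ there exists $\delta>0$ such that if $\operatorname{dist}(\phi_t(x),\phi_t(y))<\delta$ for all $t\ge 0$ then there exists $s\in\mathbb{R}$ such that $y=\phi_s(x)$ and $|s|<\epsilon$. Here $\phi_{\mathbb{R}^+}(x)=\{\phi_t(x):t\in\mathbb{R}^+\}$ is the positive orbit of $x$ and $B_\delta(\gamma)=\bigcup_{q\in\gamma}B_\delta(q)$. Singular points (points fixed by all $\phi_t$) are not regarded as periodic orbits. *)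

theory Defs
  imports "HOL-Analysis.Analysis"
begin

text \<open>
  The phase space is a subset \<open>X\<close> of a type of class \<open>metric_space\<close> with the restricted
  metric; \<open>\<phi> t\<close> is the time-\<open>t\<close> map, whose values outside \<open>X\<close> are irrelevant.
\<close>

definition continuous_flow_on :: "'a::metric_space set \<Rightarrow> (real \<Rightarrow> 'a \<Rightarrow> 'a) \<Rightarrow> bool" where
  "continuous_flow_on X \<phi> \<longleftrightarrow>
     (\<forall>t. \<forall>x\<in>X. \<phi> t x \<in> X) \<and>
     (\<forall>x\<in>X. \<phi> 0 x = x) \<and>
     (\<forall>s t. \<forall>x\<in>X. \<phi> (s + t) x = \<phi> s (\<phi> t x)) \<and>
     continuous_on (UNIV \<times> X) (\<lambda>(t, x). \<phi> t x)"

definition positive_kinematic_expansive ::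
    "'a::metric_space set \<Rightarrow> (real \<Rightarrow> 'a \<Rightarrow> 'a) \<Rightarrow> bool" where
  "positive_kinematic_expansive X \<phi> \<longleftrightarrow>
     (\<forall>\<epsilon>>0. \<exists>\<delta>>0. \<forall>x\<in>X. \<forall>y\<in>X.
        (\<forall>t\<ge>0. dist (\<phi> t x) (\<phi> t y) < \<delta>) \<longrightarrow> (\<exists>s. y = \<phi> s x \<and> \<bar>s\<bar> < \<epsilon>))"

definition flow_orbit :: "(real \<Rightarrow> 'a \<Rightarrow> 'a) \<Rightarrow> 'a \<Rightarrow> 'a set" where
  "flow_orbit \<phi> x = {\<phi> t x | t. True}"

definition positive_orbit :: "(real \<Rightarrow> 'a \<Rightarrow> 'a) \<Rightarrow> 'a \<Rightarrow> 'a set" where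
  "positive_orbit \<phi> x = {\<phi> t x | t. t \<ge> 0}"

definition singular_point :: "'a set \<Rightarrow> (real \<Rightarrow> 'a \<Rightarrow> 'a) \<Rightarrow> 'a \<Rightarrow> bool" where
  "singular_point X \<phi> x \<longleftrightarrow> x \<in> X \<and> (\<forall>t. \<phi> t x = x)"

text \<open>Singular points are not counted as periodic.\<close>

definition periodic_point :: "'a set \<Rightarrow> (real \<Rightarrow> 'a \<Rightarrow> 'a) \<Rightarrow> 'a \<Rightarrow> bool" where
  "periodic_point X \<phi> x \<longleftrightarrow>
     x \<in> X \<and> \<not> singular_point X \<phi> x \<and> (\<exists>T>0. \<phi> T x = x)"

definition periodic_orbit :: "'a set \<Rightarrow> (real \<Rightarrow> 'a \<Rightarrow> 'a) \<Rightarrow> 'a set \<Rightarrow> bool" where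
  "periodic_orbit X \<phi> \<gamma> \<longleftrightarrow> (\<exists>p. periodic_point X \<phi> p \<and> \<gamma> = flow_orbit \<phi> p)"

text \<open>The balls are those of the metric space \<open>X\<close>, hence the intersection with \<open>X\<close>.\<close>

definition ball_nbhd :: "'a::metric_space set \<Rightarrow> real \<Rightarrow> 'a set \<Rightarrow> 'a set" where
  "ball_nbhd X \<delta> \<gamma> = (\<Union>q\<in>\<gamma>. ball q \<delta> \<inter> X)"

end

theory Submission
  imports Defs
begin

text \<open>
  Let \<open>T\<close> be a period of \<open>\<gamma>\<close>. The map \<open>\<phi> T\<close> fixes \<open>\<gamma>\<close> pointwise, so by uniform continuity it
  moves every point near \<open>\<gamma>\<close> very little. Hence, if the positive orbit of \<open>x\<close> stays near \<open>\<gamma>\<close>, the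
  positive orbits of \<open>x\<close> and \<open>\<phi> T x\<close> stay close at all times, and expansiveness with \<open>\<epsilon> = T\<close> gives
  \<open>\<phi> T x = \<phi> s x\<close> with \<open>\<bar>s\<bar> < T\<close>. So \<open>x\<close> returns after time \<open>T - s > 0\<close>, and it is not
  singular because no singular points accumulate on \<open>\<gamma>\<close>.
\<close>

lemma continuous_flow_onD:
  assumes "continuous_flow_on X \<phi>" "x \<in> X"
  shows "\<phi> t x \<in> X" "\<phi> 0 x = x" "\<phi> (s + t) x = \<phi> s (\<phi> t x)"
  using assms by (auto simp: continuous_flow_on_def)

text \<open>Joint continuity becomes uniform on the compact set \<open>{-K..K} \<times> X\<close>.
  Times are kept bounded because over all of the real line no such \<open>d\<close> need
  exist.\<close>

lemma flow_equicontinuous_on_bounded_times: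
  fixes X :: "'a::metric_space set"
  assumes "compact X" "continuous_flow_on X \<phi>" "e > 0"
  obtains d where "d > 0"
    "\<And>t x y. \<lbrakk>\<bar>t\<bar> \<le> K; x \<in> X; y \<in> X; dist x y < d\<rbrakk> \<Longrightarrow> dist (\<phi> t x) (\<phi> t y) < e"
proof -
  have "continuous_on ({-K..K} \<times> X) (\<lambda>(t, x). \<phi> t x)"
    by (rule continuous_on_subset[of "UNIV \<times> X"])
      (use assms(2) in \<open>auto simp: continuous_flow_on_def\<close>)
  then have "uniformly_continuous_on ({-K..K} \<times> X) (\<lambda>(t, x). \<phi> t x)"
    using assms(1) by (intro compact_uniformly_continuous compact_Times) auto
  then obtain d where d: "d > 0"
    and D: "\<forall>a\<in>{-K..K} \<times> X. \<forall>b\<in>{-K..K} \<times> X.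
      dist b a < d \<longrightarrow> dist (case b of (t, x) \<Rightarrow> \<phi> t x) (case a of (t, x) \<Rightarrow> \<phi> t x) < e"
    using \<open>e > 0\<close> unfolding uniformly_continuous_on_def by meson
  show ?thesis
  proof (rule that[OF d])
    fix t x y assume "\<bar>t\<bar> \<le> K" "x \<in> X" "y \<in> X" "dist x y < d"
    then show "dist (\<phi> t x) (\<phi> t y) < e"
      using D[rule_format, of "(t, y)" "(t, x)"] by (auto simp: dist_Pair_Pair abs_le_iff)
  qed
qed

lemma flow_period_multiple_nat:
  assumes "continuous_flow_on X \<phi>" "p \<in> X" "\<phi> T p = p"
  shows "\<phi> (real n * T) p = p"
proof (induction n)
  case 0
  then show ?case using continuous_flow_onD[OF assms(1,2)] by simp
next
  case (Suc n)
  have "\<phi> (real n * T + T) p = p"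
    using continuous_flow_onD(3)[OF assms(1,2), of "real n * T" T] Suc assms(3) by simp
  then show ?case by (simp add: algebra_simps)
qed

lemma flow_period_multiple_int:
  assumes "continuous_flow_on X \<phi>" "p \<in> X" "\<phi> T p = p"
  shows "\<phi> (of_int k * T) p = p"
proof (cases k)
  case (nonneg n)
  then show ?thesis using flow_period_multiple_nat[OF assms] by simp
next
  case (neg n)
  \<comment> \<open>In this case \<open>k\<close> is minus \<open>Suc n\<close>, so
    \<open>k * T\<close> is a natural multiple of the period \<open>- T\<close>.\<close>
  have "\<phi> (- T) p = p"
    using continuous_flow_onD(2)[OF assms(1,2)] continuous_flow_onD(3)[OF assms(1,2), of "- T" T]
      assms(3) by simp
  from flow_period_multiple_nat[OF assms(1,2) this, of "Suc n"] show ?thesis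
    unfolding neg by (simp add: minus_mult_left)
qed

text \<open>Reducing the time modulo \<open>T\<close> bounds it, so that equicontinuity on bounded
  times applies along the entire orbit.\<close>

lemma flow_orbit_periodicE:
  assumes "continuous_flow_on X \<phi>" "p \<in> X" "T > 0" "\<phi> T p = p" "q \<in> flow_orbit \<phi> p"
  obtains u where "0 \<le> u" "u < T" "q = \<phi> u p"
proof -
  obtain v where v: "q = \<phi> v p" using assms(5) by (auto simp: flow_orbit_def)
  let ?k = "\<lfloor>v / T\<rfloor>"
  let ?u = "v - of_int ?k * T"
  have "of_int ?k * T \<le> v"
    using \<open>T > 0\<close> of_int_floor_le[of "v / T"] by (simp only: pos_le_divide_eq)
  moreover have "v < (of_int ?k + 1) * T"
    using \<open>T > 0\<close> floor_correct[of "v / T"] by (simp only: pos_divide_less_eq of_int_add of_int_1)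
  moreover have "\<phi> (?u + of_int ?k * T) p = \<phi> ?u p"
    unfolding continuous_flow_onD(3)[OF assms(1,2)] flow_period_multiple_int[OF assms(1,2,4)] ..
  ultimately show ?thesis using v that[of ?u] by (simp add: algebra_simps)
qed

text \<open>The flow moves \<open>p\<close> to a different point \<open>\<phi> r p\<close>. Carrying
  \<open>q\<close> to \<open>p\<close> and to \<open>\<phi> r p\<close> in bounded time leaves a
  singular \<open>z\<close> in place, so a \<open>z\<close> too near \<open>q\<close> would lie near
  two separated points at once.\<close>

lemma periodic_orbit_isolated_from_singular:
  fixes X :: "'a::metric_space set"
  assumes X: "compact X" and flow: "continuous_flow_on X \<phi>"
    and "periodic_point X \<phi> p"
  obtains d where "d > 0"
    "\<And>z q. \<lbrakk>q \<in> flow_orbit \<phi> p; dist q z < d\<rbrakk> \<Longrightarrow> \<not> singular_point X \<phi> z"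
proof -
  obtain T r where p: "p \<in> X" and T: "T > 0" "\<phi> T p = p" and r: "\<phi> r p \<noteq> p"
    using assms(3) by (auto simp: periodic_point_def singular_point_def)
  note flowD = continuous_flow_onD[OF flow]
  have "dist (\<phi> r p) p / 2 > 0" using r by simp
  \<comment> \<open>The time bound covers both \<open>- u\<close> and \<open>r - u\<close> for
    \<open>0 \<le> u < T\<close>. Half the distance lets the triangle inequality through
    \<open>z\<close> give a contradiction.\<close>
  then obtain d where d: "d > 0" and D: "\<And>t x y. \<lbrakk>\<bar>t\<bar> \<le> \<bar>r\<bar> + T; x \<in> X; y \<in> X; dist x y < d\<rbrakk>
      \<Longrightarrow> dist (\<phi> t x) (\<phi> t y) < dist (\<phi> r p) p / 2"
    using flow_equicontinuous_on_bounded_times[OF X flow] by metis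
  show ?thesis
  proof (rule that[OF d], rule notI)
    fix z q
    assume q: "q \<in> flow_orbit \<phi> p" "dist q z < d" and z: "singular_point X \<phi> z"
    obtain u where u: "0 \<le> u" "u < T" "q = \<phi> u p"
      using flow_orbit_periodicE[OF flow p T q(1)] .
    have qX: "q \<in> X" "z \<in> X" using u(3) flowD(1)[OF p] z by (auto simp: singular_point_def)
    have stays: "\<phi> t z = z" for t using z by (simp add: singular_point_def)
    have pull_back: "\<phi> (t - u) q = \<phi> t p" for t
      using flowD(3)[OF p, of "t - u" u] u(3) by simp
    have "dist (\<phi> (0 - u) q) (\<phi> (0 - u) z) < dist (\<phi> r p) p / 2"
      using u by (intro D qX q) auto
    then have "dist p z < dist (\<phi> r p) p / 2"
      using pull_back[of 0] flowD(2)[OF p] stays by simp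
    moreover have "dist (\<phi> (r - u) q) (\<phi> (r - u) z) < dist (\<phi> r p) p / 2"
      using u by (intro D qX q) auto
    then have "dist (\<phi> r p) z < dist (\<phi> r p) p / 2"
      using pull_back[of r] stays by simp
    ultimately show False
      using dist_triangle2[of "\<phi> r p" p z] by linarith
  qed
qed

text \<open>Since \<open>\<phi> T\<close> fixes each orbit point, compare \<open>z\<close> and
  \<open>\<phi> T z\<close> with the same nearby orbit point; each distance costs at most
  \<open>e / 2\<close>.\<close>

lemma period_almost_fixes_nbhd:
  fixes X :: "'a::metric_space set"
  assumes X: "compact X" and flow: "continuous_flow_on X \<phi>"
    and p: "p \<in> X" and T: "\<phi> T p = p" and "e > 0"
  obtains d where "d > 0"
    "\<And>z. z \<in> ball_nbhd X d (flow_orbit \<phi> p) \<Longrightarrow> dist z (\<phi> T z) < e"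
proof -
  note flowD = continuous_flow_onD[OF flow]
  have "e / 2 > 0" using \<open>e > 0\<close> by simp
  then obtain d where d: "d > 0" and D: "\<And>t x y. \<lbrakk>\<bar>t\<bar> \<le> \<bar>T\<bar>; x \<in> X; y \<in> X; dist x y < d\<rbrakk>
      \<Longrightarrow> dist (\<phi> t x) (\<phi> t y) < e / 2"
    using flow_equicontinuous_on_bounded_times[OF X flow] by metis
  show ?thesis
  \<comment> \<open>Here \<open>d\<close> controls the distance after applying
    \<open>\<phi> T\<close>, and \<open>e / 2\<close> the distance before.\<close>
  proof (rule that[of "min d (e / 2)"])
    show "min d (e / 2) > 0" using d \<open>e > 0\<close> by simp
    fix z assume "z \<in> ball_nbhd X (min d (e / 2)) (flow_orbit \<phi> p)"
    then obtain u where z: "z \<in> X" "dist (\<phi> u p) z < d" "dist (\<phi> u p) z < e / 2"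
      by (auto simp: ball_nbhd_def flow_orbit_def)
    have "\<phi> T (\<phi> u p) = \<phi> u p"
      using flowD(3)[OF p, of T u] flowD(3)[OF p, of u T] T by (simp add: add.commute)
    then have "dist (\<phi> u p) (\<phi> T z) < e / 2"
      using D[OF _ flowD(1)[OF p] z(1,2), of T] by simp
    then show "dist z (\<phi> T z) < e"
      using z(3) dist_triangle3[of z "\<phi> T z" "\<phi> u p"] by linarith
  qed
qed

theorem proposition6p3:
  fixes X :: "'a::metric_space set" and \<phi> :: "real \<Rightarrow> 'a \<Rightarrow> 'a" and \<gamma> :: "'a set"
  assumes "compact X"
    and "continuous_flow_on X \<phi>"
    and "positive_kinematic_expansive X \<phi>"
    and "periodic_orbit X \<phi> \<gamma>"
  shows "\<exists>\<delta>>0. \<forall>x\<in>X. positive_orbit \<phi> x \<subseteq> ball_nbhd X \<delta> \<gamma> \<and> x \<notin> \<gamma> \<longrightarrow> periodic_point X \<phi> x"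
proof -
  note flowD = continuous_flow_onD[OF assms(2)]
  obtain p where p: "periodic_point X \<phi> p" and \<gamma>: "\<gamma> = flow_orbit \<phi> p"
    using assms(4) by (auto simp: periodic_orbit_def)
  obtain T where pX: "p \<in> X" and T: "T > 0" "\<phi> T p = p"
    using p by (auto simp: periodic_point_def)
  \<comment> \<open>The strict bound by the period itself is what later makes the return time
    \<open>T - s\<close> positive.\<close>
  obtain e where "e > 0" and e: "\<And>x y. \<lbrakk>x \<in> X; y \<in> X; \<forall>t\<ge>0. dist (\<phi> t x) (\<phi> t y) < e\<rbrakk>
      \<Longrightarrow> \<exists>s. y = \<phi> s x \<and> \<bar>s\<bar> < T"
    using assms(3) T(1) unfolding positive_kinematic_expansive_def by meson
  obtain d1 where d1: "d1 > 0"
    "\<And>z. z \<in> ball_nbhd X d1 \<gamma> \<Longrightarrow> dist z (\<phi> T z) < e"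
    using period_almost_fixes_nbhd[OF assms(1,2) pX T(2) \<open>e > 0\<close>] \<gamma> by metis
  obtain d2 where d2: "d2 > 0"
    "\<And>z q. \<lbrakk>q \<in> \<gamma>; dist q z < d2\<rbrakk> \<Longrightarrow> \<not> singular_point X \<phi> z"
    using periodic_orbit_isolated_from_singular[OF assms(1,2) p] \<gamma> by metis
  show ?thesis
  \<comment> \<open>The radius \<open>d1\<close> serves the expansiveness argument, and
    \<open>d2\<close> rules out that \<open>x\<close> is singular.\<close>
  proof (intro exI[of _ "min d1 d2"] conjI ballI impI)
    show "min d1 d2 > 0" using d1(1) d2(1) by simp
    fix x assume x: "x \<in> X" and "positive_orbit \<phi> x \<subseteq> ball_nbhd X (min d1 d2) \<gamma> \<and> x \<notin> \<gamma>"
    then have near: "\<phi> t x \<in> ball_nbhd X (min d1 d2) \<gamma>" if "t \<ge> 0" for t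
      using that by (auto simp: positive_orbit_def)
    have "dist (\<phi> t x) (\<phi> t (\<phi> T x)) < e" if "t \<ge> 0" for t
    proof -
      have "\<phi> t x \<in> ball_nbhd X d1 \<gamma>"
        using near[OF that] by (auto simp: ball_nbhd_def)
      \<comment> \<open>Time maps commute, so comparing the two orbits at time \<open>t\<close>
        amounts to measuring how far \<open>\<phi> T\<close> moves the single point
        \<open>\<phi> t x\<close>, which is near \<open>\<gamma>\<close>.\<close>
      moreover have "\<phi> t (\<phi> T x) = \<phi> T (\<phi> t x)"
        using flowD(3)[OF x, of t T] flowD(3)[OF x, of T t] by (simp add: add.commute)
      ultimately show ?thesis using d1(2) by simp
    qed
    then obtain s where s: "\<phi> T x = \<phi> s x" "\<bar>s\<bar> < T"
      using e[OF x flowD(1)[OF x, of T]] by blast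
    have "\<phi> (T - s) x = \<phi> (- s) (\<phi> T x)"
      using flowD(3)[OF x, of "- s" T] by simp
    also have "\<dots> = x"
      using flowD(3)[OF x, of "- s" s] flowD(2)[OF x] s(1) by simp
    finally have "\<phi> (T - s) x = x" .
    moreover have "T - s > 0" using s(2) by simp
    \<comment> \<open>Time 0 of the positive orbit places \<open>x\<close> itself near
      \<open>\<gamma>\<close>.\<close>
    moreover have "\<not> singular_point X \<phi> x"
      using near[of 0] flowD(2)[OF x] d2(2) by (auto simp: ball_nbhd_def)
    ultimately show "periodic_point X \<phi> x"
      using x unfolding periodic_point_def by blast
  qed
qed

end
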